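(* The following assertions hold. (1) Any subspace of an $\mathbb R^{\omega_1}$-factorizable space is $\mathbb R^{\omega_1}$-factorizable. (2) If $X_n$, $n\in\omega$, are $\mathbb R^{\omega_1}$-factorizable spaces, then the topological sum $\bigoplus_{n\in\omega}X_n$ is $\mathbb R^{\omega_1}$-factorizable. (3) If $X_n$, $n\in\omega$, are $\mathbb R^{\omega_1}$-factorizable spaces, then the product $\prod_{n\in\omega}X_n$ is $\mathbb R^{\omega_1}$-factorizable.
   Context: All topological spaces are assumed to be Tychonoff. A space $X$ is $\mathbb R^{\omega_1}$-factorizable if for every continuous function $f\colon X\to\mathbb R^{\omega_1}$ there exist a second-countable space $Y$ and continuous functions $h\colon X\to Y$ and $g\colon Y\to\mathbb R^{\omega_1}$ such that $f=g\circ h$. *)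

theory Defs
  imports "HOL-Analysis.Analysis"
begin

definition tychonoff_space :: "'a topology \<Rightarrow> bool" where
  "tychonoff_space X \<longleftrightarrow> completely_regular_space X \<and> Hausdorff_space X"

definition second_countable_space :: "'a topology \<Rightarrow> bool" where
  "second_countable_space X \<longleftrightarrow>
     (\<exists>\<B>. countable \<B> \<and> (\<forall>V\<in>\<B>. openin X V) \<and>
          (\<forall>U x. openin X U \<and> x \<in> U \<longrightarrow> (\<exists>V\<in>\<B>. x \<in> V \<and> V \<subseteq> U)))"

text \<open>The underlying set of the cardinal successor of \<open>\<omega>\<close>; only its cardinality matters.\<close>

definition omega1 :: "nat set set" where
  "omega1 = Field (cardSuc natLeq)"

abbreviation R_omega1 :: "(nat set \<Rightarrow> real) topology" where
  "R_omega1 \<equiv> product_topology (\<lambda>_. euclideanreal) omega1"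

text \<open>
  All spaces are Tychonoff by convention, so this is required of both \<open>X\<close> and \<open>Y\<close>.
  HOL cannot quantify existentially over types, hence \<open>Y\<close> ranges over the topologies whose
  points lie in \<open>nat \<Rightarrow> real\<close>. Its carrier is an arbitrary subset of that type and its topology
  is arbitrary. This is no restriction, because every second-countable Tychonoff space, on
  whatever type, has a homeomorphic copy there: see \<open>second_countable_tychonoff_copy\<close> and
  \<open>R_omega1_factorizableI\<close> below.
\<close>

definition R_omega1_factorizable :: "'a topology \<Rightarrow> bool" where
  "R_omega1_factorizable X \<longleftrightarrow>
     tychonoff_space X \<and>
     (\<forall>f. continuous_map X R_omega1 f \<longrightarrow>
        (\<exists>(Y :: (nat \<Rightarrow> real) topology) h g.
           tychonoff_space Y \<and> second_countable_space Y \<and>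
           continuous_map X Y h \<and> continuous_map Y R_omega1 g \<and>
           (\<forall>x\<in>topspace X. f x = (g \<circ> h) x)))"

lemma tychonoff_space_homeomorphic:
  "X homeomorphic_space Y \<Longrightarrow> tychonoff_space X \<longleftrightarrow> tychonoff_space Y"
  unfolding tychonoff_space_def
  using homeomorphic_completely_regular_space homeomorphic_Hausdorff_space by blast

lemma second_countable_space_homeomorphic:
  assumes "X homeomorphic_space Y" "second_countable_space X"
  shows "second_countable_space Y"
proof -
  obtain f g where fg: "homeomorphic_maps X Y f g"
    using assms(1) unfolding homeomorphic_space_def by blast
  obtain \<B> where B: "countable \<B>" "\<And>V. V \<in> \<B> \<Longrightarrow> openin X V"
    "\<And>U x. openin X U \<Longrightarrow> x \<in> U \<Longrightarrow> \<exists>V\<in>\<B>. x \<in> V \<and> V \<subseteq> U"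
    using assms(2) unfolding second_countable_space_def by metis
  have cf: "continuous_map X Y f" and cg: "continuous_map Y X g"
    and gf: "\<And>x. x \<in> topspace X \<Longrightarrow> g (f x) = x" and fg': "\<And>y. y \<in> topspace Y \<Longrightarrow> f (g y) = y"
    using fg unfolding homeomorphic_maps_def by auto
  have hf: "homeomorphic_map X Y f" using fg homeomorphic_maps_map by blast
  show ?thesis
    unfolding second_countable_space_def
  proof (intro exI[of _ "(`) f ` \<B>"] conjI ballI allI impI)
    show "countable ((`) f ` \<B>)" using B(1) by blast
  next
    fix V assume "V \<in> (`) f ` \<B>"
    then show "openin Y V"
      using B(2) hf homeomorphic_imp_open_map unfolding open_map_def by blast
  next
    fix U y assume a: "openin Y U \<and> y \<in> U"
    then have y: "y \<in> topspace Y" using openin_subset by blast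
    have gy: "g y \<in> topspace X" using cg y by (auto simp: continuous_map_def Pi_iff)
    let ?U = "{x \<in> topspace X. f x \<in> U}"
    have "openin X ?U" using cf a by (simp add: openin_continuous_map_preimage)
    moreover have "g y \<in> ?U" using gy fg' y a by simp
    ultimately obtain V where V: "V \<in> \<B>" "g y \<in> V" "V \<subseteq> ?U" using B(3) by meson
    have "y \<in> f ` V" using V(2) fg' y by force
    then show "\<exists>W\<in>(`) f ` \<B>. y \<in> W \<and> W \<subseteq> U" using V by blast
  qed
qed

lemma second_countable_tychonoff_copy:
  fixes Y :: "'b topology"
  assumes "tychonoff_space Y" "second_countable_space Y"
  obtains Z :: "(nat \<Rightarrow> real) topology" where "Y homeomorphic_space Z"
proof -
  obtain \<B> where B: "countable \<B>" "\<And>V. V \<in> \<B> \<Longrightarrow> openin Y V"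
    "\<And>U x. openin Y U \<Longrightarrow> x \<in> U \<Longrightarrow> \<exists>V\<in>\<B>. x \<in> V \<and> V \<subseteq> U"
    using assms(2) unfolding second_countable_space_def by metis
  define b where "b = from_nat_into (insert {} \<B>)"
  have b: "\<exists>n. b n = V" if "V \<in> \<B>" for V
    using that B(1) unfolding b_def by (metis countable_insert from_nat_into_surj insertCI)
  define \<phi> where "\<phi> x = (\<lambda>n. of_bool (x \<in> b n) :: real)" for x
  have inj: "inj_on \<phi> (topspace Y)"
  proof (rule inj_onI, rule ccontr)
    fix x y assume xy: "x \<in> topspace Y" "y \<in> topspace Y" "\<phi> x = \<phi> y" "x \<noteq> y"
    then obtain U where U: "openin Y U" "x \<in> U" "y \<notin> U"
      using assms(1) unfolding tychonoff_space_def Hausdorff_space_def disjnt_def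
      by (metis Int_iff empty_iff)
    then obtain V where V: "V \<in> \<B>" "x \<in> V" "V \<subseteq> U" using B(3) by meson
    then obtain n where "b n = V" using b by blast
    then show False using fun_cong[OF xy(3), of n] V U by (auto simp: \<phi>_def)
  qed
  define \<psi> where "\<psi> = inv_into (topspace Y) \<phi>"
  define Z where "Z = pullback_topology (\<phi> ` topspace Y) \<psi> Y"
  have \<psi>: "\<psi> (\<phi> x) = x" if "x \<in> topspace Y" for x
    using that inj by (simp add: \<psi>_def)
  have tZ: "topspace Z = \<phi> ` topspace Y"
    unfolding Z_def topspace_pullback_topology using \<psi> by auto
  have "homeomorphic_maps Y Z \<phi> \<psi>"
    unfolding homeomorphic_maps_def
  proof (intro conjI ballI)
    show "continuous_map Z Y \<psi>"
      unfolding continuous_map_def tZ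
      by (auto simp: \<psi> Z_def openin_pullback_topology)
    have "openin Y {x \<in> topspace Y. \<phi> x \<in> U}" if U: "openin Z U" for U
    proof -
      obtain S where S: "openin Y S" "U = \<psi> -` S \<inter> \<phi> ` topspace Y"
        using U unfolding Z_def openin_pullback_topology by blast
      have "{x \<in> topspace Y. \<phi> x \<in> U} = S"
      proof (intro set_eqI iffI)
        fix x assume "x \<in> {x \<in> topspace Y. \<phi> x \<in> U}"
        then show "x \<in> S" using \<psi>[of x] S(2) by simp
      next
        fix x assume "x \<in> S"
        then show "x \<in> {x \<in> topspace Y. \<phi> x \<in> U}"
          using \<psi>[of x] S openin_subset[OF S(1)] by auto
      qed
      then show ?thesis using S(1) by simp
    qed
    then show "continuous_map Y Z \<phi>"
      unfolding continuous_map_def tZ by blast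
  qed (use \<psi> tZ in auto)
  then show thesis
    using that homeomorphic_space_def by blast
qed

lemma R_omega1_factorizableI:
  fixes X :: "'a topology"
  assumes "tychonoff_space X"
    and *: "\<And>f. continuous_map X R_omega1 f \<Longrightarrow>
      \<exists>(Y :: 'b topology) h g.
           tychonoff_space Y \<and> second_countable_space Y \<and>
           continuous_map X Y h \<and> continuous_map Y R_omega1 g \<and>
           (\<forall>x\<in>topspace X. f x = (g \<circ> h) x)"
  shows "R_omega1_factorizable X"
  unfolding R_omega1_factorizable_def
proof (intro conjI allI impI)
  fix f assume "continuous_map X R_omega1 f"
  then obtain Y :: "'b topology" and h g where Y: "tychonoff_space Y" "second_countable_space Y"
    "continuous_map X Y h" "continuous_map Y R_omega1 g" "\<And>x. x \<in> topspace X \<Longrightarrow> f x = g (h x)"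
    using * by fastforce
  obtain Z :: "(nat \<Rightarrow> real) topology" where Z: "Y homeomorphic_space Z"
    using second_countable_tychonoff_copy Y by blast
  then obtain p q where pq: "homeomorphic_maps Y Z p q"
    unfolding homeomorphic_space_def by blast
  have qp: "q (p (h x)) = h x" if "x \<in> topspace X" for x
    using pq Y(3) that unfolding homeomorphic_maps_def continuous_map_def by blast
  have "continuous_map X Z (p \<circ> h)" "continuous_map Z R_omega1 (g \<circ> q)"
    using pq Y continuous_map_compose unfolding homeomorphic_maps_def by blast+
  then show "\<exists>(Y :: (nat \<Rightarrow> real) topology) h g.
           tychonoff_space Y \<and> second_countable_space Y \<and>
           continuous_map X Y h \<and> continuous_map Y R_omega1 g \<and>
           (\<forall>x\<in>topspace X. f x = (g \<circ> h) x)"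
    using Z Y tychonoff_space_homeomorphic second_countable_space_homeomorphic qp
    by (intro exI[of _ Z] exI[of _ "p \<circ> h"] exI[of _ "g \<circ> q"]) auto
qed (rule assms(1))

end

theory Submission
  imports Defs
begin

text \<open>
  A map \<open>f\<close> into \<open>\<real>\<^sup>\<kappa>\<close> with \<open>\<kappa> = \<omega>\<^sub>1\<close> is a family of \<open>\<omega>\<^sub>1\<close> real functions, and it is
  determined by the \<open>\<omega>\<^sub>1\<close> many open sets \<open>{x. f x \<alpha> \<in> G}\<close>, where \<open>G\<close> runs through a countable
  base of the line. A factorization of \<open>f\<close> through a second-countable space amounts to a
  countable family \<open>\<C>\<close> of open sets such that each of these sets is a union of members of \<open>\<C>\<close>:
  one passes from the space to \<open>\<C>\<close> by pulling back a countable base, and from \<open>\<C>\<close> to the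
  space by evaluating countably many real functions. This suggests the criterion
  \<open>R_omega1_factorizable_iff_omega1_resolvable\<close>: a Tychonoff space is factorizable iff every
  family of at most \<open>\<omega>\<^sub>1\<close> open sets is resolved in this way by a countable family.

  Factorizability by itself speaks of cozero sets only, and the boxes of a product also cover
  only some open sets. Both families are bases, and the heart of the proof is that a base is
  enough (\<open>omega1_resolvable_from_base\<close>). If some open \<open>U\<close> were not a countable union of
  basic sets, one could choose points \<open>x\<^sub>\<alpha> \<in> U\<close> and basic sets \<open>B\<^sub>\<alpha> \<subseteq> U\<close> around them for
  \<open>\<alpha> < \<omega>\<^sub>1\<close>, with every \<open>x\<^sub>\<alpha>\<close> outside all earlier \<open>B\<^sub>\<beta>\<close>. A countable family resolving all the
  \<open>B\<^sub>\<alpha>\<close> contains sets \<open>C\<^sub>\<alpha>\<close> with \<open>x\<^sub>\<alpha> \<in> C\<^sub>\<alpha> \<subseteq> B\<^sub>\<alpha>\<close>, and these are pairwise distinct, which is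
  absurd (\<open>omega1_resolvable_imp_countable_subcover\<close>). So every open set is a countable union of
  basic sets, and a resolution of \<open>\<omega>\<^sub>1\<close> basic sets resolves \<open>\<omega>\<^sub>1\<close> open sets. In particular a
  factorizable space is hereditarily Lindelof.

  With the criterion the three permanence properties are short. For a subspace one takes traces
  of a resolving family; for a countable sum one takes the union of resolving families of the
  summands; for a countable product one resolves the sides of the boxes in each factor and takes
  finite intersections of cylinders, so that boxes, hence all open sets, are resolved.
\<close>

section \<open>The first uncountable cardinal\<close>

lemma Card_order_omega1: "Card_order (cardSuc natLeq)"
  using cardSuc_Card_order natLeq_Card_order by blast

context
  includes cardinal_syntax
begin

lemma countable_iff_ordLeq_natLeq: "countable A \<longleftrightarrow> |A| \<le>o natLeq"
proof -
  have "countable A \<longleftrightarrow> |A| \<le>o |UNIV::nat set|"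
    unfolding countable_def card_of_ordLeq[symmetric] by auto
  also have "\<dots> \<longleftrightarrow> |A| \<le>o natLeq"
    using card_of_nat ordLeq_ordIso_trans ordIso_symmetric by blast
  finally show ?thesis .
qed

lemma uncountable_omega1: "uncountable omega1"
proof
  assume "countable omega1"
  then have "|omega1| <o cardSuc natLeq"
    by (metis cardSuc_ordLeq_ordLess card_of_Card_order countable_iff_ordLeq_natLeq natLeq_Card_order)
  moreover have "|omega1| =o cardSuc natLeq"
    unfolding omega1_def using Card_order_omega1 by (rule card_of_Field_ordIso)
  ultimately show False
    using not_ordLess_ordIso by blast
qed

lemma lepoll_omega1_UN_countable:
  assumes "I \<lesssim> omega1" "\<And>i. i \<in> I \<Longrightarrow> countable (A i)"
  shows "(\<Union>i\<in>I. A i) \<lesssim> omega1"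
proof -
  have inf: "infinite omega1"
    using uncountable_omega1 countable_finite by blast
  have I: "|I| \<le>o |omega1|"
    using assms(1) by (simp add: lepoll_def card_of_ordLeq)
  have "natLeq \<le>o |omega1|"
    using inf infinite_iff_natLeq_ordLeq by blast
  then have "\<forall>i\<in>I. |A i| \<le>o |omega1|"
    using assms(2) countable_iff_ordLeq_natLeq ordLeq_transitive by blast
  then have "|\<Union>i\<in>I. A i| \<le>o |omega1|"
    using card_of_UNION_ordLeq_infinite[OF inf I] by blast
  then show ?thesis
    by (simp add: lepoll_def card_of_ordLeq)
qed

text \<open>
  A cardinal is an initial ordinal, so proper initial segments of the well-order on \<open>omega1\<close>
  are countable: a recursion along it always has used up only countably many earlier values.
\<close>

lemma omega1_wellorder:
  obtains R where "wf R" "\<And>\<alpha>. countable {\<beta>. (\<beta>, \<alpha>) \<in> R}"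
    "\<And>\<alpha> \<beta>. \<alpha> \<in> omega1 \<Longrightarrow> \<beta> \<in> omega1 \<Longrightarrow> \<alpha> \<noteq> \<beta> \<Longrightarrow> (\<alpha>, \<beta>) \<in> R \<or> (\<beta>, \<alpha>) \<in> R"
proof
  let ?r = "cardSuc natLeq"
  have wo: "Well_order ?r"
    using Card_order_omega1 card_order_on_well_order_on by blast
  show "wf (?r - Id)"
    using wo by (simp add: well_order_on_def)
  show "countable {\<beta>. (\<beta>, \<alpha>) \<in> ?r - Id}" for \<alpha>
  proof (cases "\<alpha> \<in> Field ?r")
    case True
    have "|underS ?r \<alpha>| <o ?r"
      using card_of_underS[OF Card_order_omega1 True] .
    then have "countable (underS ?r \<alpha>)"
      by (simp add: countable_iff_ordLeq_natLeq cardSuc_ordLeq_ordLess natLeq_Card_order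
          card_of_Card_order)
    moreover have "{\<beta>. (\<beta>, \<alpha>) \<in> ?r - Id} \<subseteq> underS ?r \<alpha>"
      by (auto simp: underS_def)
    ultimately show ?thesis
      using countable_subset by blast
  next
    case False
    then have "{\<beta>. (\<beta>, \<alpha>) \<in> ?r - Id} = {}"
      by (auto simp: Field_def)
    then show ?thesis
      by (simp only: countable_empty)
  qed
  show "(\<alpha>, \<beta>) \<in> ?r - Id \<or> (\<beta>, \<alpha>) \<in> ?r - Id"
    if "\<alpha> \<in> omega1" "\<beta> \<in> omega1" "\<alpha> \<noteq> \<beta>" for \<alpha> \<beta>
    using wo that unfolding omega1_def order_on_defs total_on_def by auto
qed

end

section \<open>Resolving families of open sets\<close>

text \<open>This says that \<open>U\<close> is a union of members of \<open>\<C>\<close>; for \<open>\<B>\<close> to be a base of \<open>X\<close> is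
  therefore to be a family of open sets that resolves every open set.\<close>

definition resolves :: "'a set set \<Rightarrow> 'a set \<Rightarrow> bool" where
  "resolves \<C> U \<longleftrightarrow> (\<forall>x\<in>U. \<exists>C\<in>\<C>. x \<in> C \<and> C \<subseteq> U)"

lemma resolvesD: "resolves \<C> U \<Longrightarrow> x \<in> U \<Longrightarrow> \<exists>C\<in>\<C>. x \<in> C \<and> C \<subseteq> U"
  by (auto simp: resolves_def)

lemma resolves_trans: "resolves \<D> U \<Longrightarrow> (\<And>V. V \<in> \<D> \<Longrightarrow> resolves \<C> V) \<Longrightarrow> resolves \<C> U"
  unfolding resolves_def by (meson subset_trans)

lemma resolves_mono: "resolves \<C> U \<Longrightarrow> \<C> \<subseteq> \<C>' \<Longrightarrow> resolves \<C>' U"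
  unfolding resolves_def by blast

definition countable_open_resolution :: "'a topology \<Rightarrow> 'a set set \<Rightarrow> 'a set set \<Rightarrow> bool" where
  "countable_open_resolution X \<U> \<C> \<longleftrightarrow>
     countable \<C> \<and> (\<forall>C\<in>\<C>. openin X C) \<and> (\<forall>U\<in>\<U>. resolves \<C> U)"

lemma countable_open_resolutionD:
  assumes "countable_open_resolution X \<U> \<C>"
  shows "countable \<C>" "\<And>C. C \<in> \<C> \<Longrightarrow> openin X C" "\<And>U. U \<in> \<U> \<Longrightarrow> resolves \<C> U"
  using assms by (auto simp: countable_open_resolution_def)

lemma ex_countable_open_resolutionI:
  assumes "countable \<C>" "\<And>C. C \<in> \<C> \<Longrightarrow> openin X C" "\<And>U. U \<in> \<U> \<Longrightarrow> resolves \<C> U"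
  shows "\<exists>\<C>. countable_open_resolution X \<U> \<C>"
  using assms unfolding countable_open_resolution_def by (intro exI[of _ \<C>] conjI ballI)

text \<open>
  The family \<open>\<B>\<close> is a parameter because the property is first established for subfamilies of a
  convenient base, and only afterwards for all open sets. The resolving sets need not belong
  to \<open>\<B>\<close>.
\<close>

definition omega1_resolvable :: "'a topology \<Rightarrow> 'a set set \<Rightarrow> bool" where
  "omega1_resolvable X \<B> \<longleftrightarrow>
     (\<forall>\<U>\<subseteq>\<B>. \<U> \<lesssim> omega1 \<longrightarrow> (\<exists>\<C>. countable_open_resolution X \<U> \<C>))"

lemma omega1_resolvableD:
  assumes "omega1_resolvable X \<B>" "\<U> \<subseteq> \<B>" "\<U> \<lesssim> omega1"
  shows "\<exists>\<C>. countable_open_resolution X \<U> \<C>"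
  using assms unfolding omega1_resolvable_def by blast

lemma omega1_resolvable_subset:
  "omega1_resolvable X \<B> \<Longrightarrow> \<A> \<subseteq> \<B> \<Longrightarrow> omega1_resolvable X \<A>"
  unfolding omega1_resolvable_def by (meson subset_trans)

text \<open>
  A right-separated sequence of length \<open>\<omega>\<^sub>1\<close> cannot be resolved by countably many sets: the
  sets of the resolution chosen at its points would be pairwise distinct. Without a countable
  subcover, transfinite recursion produces such a sequence.
\<close>

lemma omega1_resolvable_imp_countable_subcover:
  assumes res: "omega1_resolvable X \<B>" and U: "resolves \<B> U"
  obtains \<D> where "countable \<D>" "\<D> \<subseteq> \<B>" "resolves \<D> U"
proof -
  have "\<exists>\<D>. countable \<D> \<and> \<D> \<subseteq> {B \<in> \<B>. B \<subseteq> U} \<and> U \<subseteq> \<Union>\<D>"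
  proof (rule ccontr)
    assume "\<not> ?thesis"
    then have no: "\<not> U \<subseteq> \<Union>\<D>" if "countable \<D>" "\<D> \<subseteq> {B \<in> \<B>. B \<subseteq> U}" for \<D>
      using that by blast
    obtain R where R: "wf R" "\<And>\<alpha>. countable {\<beta>. (\<beta>, \<alpha>) \<in> R}"
      and tot: "\<And>\<alpha> \<beta>. \<alpha> \<in> omega1 \<Longrightarrow> \<beta> \<in> omega1 \<Longrightarrow> \<alpha> \<noteq> \<beta> \<Longrightarrow> (\<alpha>, \<beta>) \<in> R \<or> (\<beta>, \<alpha>) \<in> R"
      by (rule omega1_wellorder) blast
    \<comment> \<open>\<open>P f \<alpha> (x, B)\<close> says that \<open>(x, B)\<close> is an admissible choice at stage \<open>\<alpha>\<close>, given the
      choices \<open>f\<close> at earlier stages.\<close>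
    define P where "P f \<alpha> p \<longleftrightarrow> fst p \<in> U \<and> snd p \<in> \<B> \<and> snd p \<subseteq> U \<and> fst p \<in> snd p \<and>
        (\<forall>\<beta>. (\<beta>, \<alpha>) \<in> R \<longrightarrow> fst p \<notin> snd (f \<beta>))"
      for f :: "nat set \<Rightarrow> 'a \<times> 'a set" and \<alpha> p
    have "\<exists>f. \<forall>\<alpha>. P f \<alpha> (f \<alpha>)"
    proof (rule dependent_wf_choice[OF R(1)])
      show "P f \<alpha> p = P g \<alpha> p" if "\<And>\<beta>. (\<beta>, \<alpha>) \<in> R \<Longrightarrow> f \<beta> = g \<beta>" for f g \<alpha> p
        using that by (auto simp: P_def)
    next
      fix \<alpha> f assume f: "\<And>\<beta>. (\<beta>, \<alpha>) \<in> R \<Longrightarrow> P f \<beta> (f \<beta>)"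
      let ?\<D> = "(\<lambda>\<beta>. snd (f \<beta>)) ` {\<beta>. (\<beta>, \<alpha>) \<in> R}"
      have "countable ?\<D>"
        using R(2) by simp
      moreover have "?\<D> \<subseteq> {B \<in> \<B>. B \<subseteq> U}"
        using f by (auto simp: P_def)
      ultimately have "\<not> U \<subseteq> \<Union>?\<D>"
        by (rule no)
      then obtain x where x: "x \<in> U" "x \<notin> \<Union>?\<D>"
        by blast
      obtain B where "B \<in> \<B>" "x \<in> B" "B \<subseteq> U"
        using resolvesD[OF U x(1)] by blast
      then show "\<exists>p. P f \<alpha> p"
        using x by (intro exI[of _ "(x, B)"]) (auto simp: P_def)
    qed
    then obtain f where f: "\<And>\<alpha>. P f \<alpha> (f \<alpha>)"
      by blast
    define x where "x \<alpha> = fst (f \<alpha>)" for \<alpha>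
    define B where "B \<alpha> = snd (f \<alpha>)" for \<alpha>
    have B: "B \<alpha> \<in> \<B>" "x \<alpha> \<in> B \<alpha>" and sep: "\<And>\<beta>. (\<beta>, \<alpha>) \<in> R \<Longrightarrow> x \<alpha> \<notin> B \<beta>" for \<alpha>
      using f[of \<alpha>] by (auto simp: P_def x_def B_def)
    have "B ` omega1 \<subseteq> \<B>" "B ` omega1 \<lesssim> omega1"
      using B(1) image_lepoll by auto
    then obtain \<C> where "countable_open_resolution X (B ` omega1) \<C>"
      using omega1_resolvableD[OF res] by blast
    note \<C> = countable_open_resolutionD[OF this]
    have "\<exists>C\<in>\<C>. x \<alpha> \<in> C \<and> C \<subseteq> B \<alpha>" if "\<alpha> \<in> omega1" for \<alpha>
      by (rule resolvesD[OF \<C>(3)[OF imageI[OF that]] B(2)])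
    then obtain C where C: "\<And>\<alpha>. \<alpha> \<in> omega1 \<Longrightarrow> C \<alpha> \<in> \<C> \<and> x \<alpha> \<in> C \<alpha> \<and> C \<alpha> \<subseteq> B \<alpha>"
      by metis
    have "inj_on C omega1"
    proof (rule inj_onI, rule ccontr)
      fix \<alpha> \<beta> assume "\<alpha> \<in> omega1" "\<beta> \<in> omega1" "C \<alpha> = C \<beta>" "\<alpha> \<noteq> \<beta>"
      then show False
        using tot[of \<alpha> \<beta>] sep C by blast
    qed
    moreover have "countable (C ` omega1)"
      using C \<C>(1) by (meson countable_subset image_subsetI)
    ultimately show False
      using uncountable_omega1 countable_image_inj_on by blast
  qed
  then obtain \<D> where \<D>: "countable \<D>" "\<D> \<subseteq> {B \<in> \<B>. B \<subseteq> U}" "U \<subseteq> \<Union>\<D>"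
    by blast
  show thesis
  proof (rule that)
    show "resolves \<D> U"
      unfolding resolves_def
    proof
      fix x assume "x \<in> U"
      then obtain B where "B \<in> \<D>" "x \<in> B"
        using \<D>(3) by blast
      then show "\<exists>B\<in>\<D>. x \<in> B \<and> B \<subseteq> U"
        using \<D>(2) by (intro bexI[of _ B]) auto
    qed
  qed (use \<D> in auto)
qed

text \<open>
  Each open set is replaced by the countably many basic sets that make it up; as
  \<open>\<omega>\<^sub>1 \<cdot> \<omega> = \<omega>\<^sub>1\<close>, there are still at most \<open>\<omega>\<^sub>1\<close> of them, and resolving is transitive.
\<close>

lemma omega1_resolvable_from_base:
  assumes res: "omega1_resolvable X \<B>" and base: "\<And>U. openin X U \<Longrightarrow> resolves \<B> U"
  shows "omega1_resolvable X (Collect (openin X))"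
  unfolding omega1_resolvable_def
proof (intro allI impI)
  fix \<U> assume \<U>: "\<U> \<subseteq> Collect (openin X)" "\<U> \<lesssim> omega1"
  have "\<exists>\<D>. countable \<D> \<and> \<D> \<subseteq> \<B> \<and> resolves \<D> U" if "U \<in> \<U>" for U
  proof -
    have "openin X U"
      using that \<U>(1) by blast
    then show ?thesis
      by (rule omega1_resolvable_imp_countable_subcover[OF res base]) blast
  qed
  then obtain \<D> where \<D>: "\<And>U. U \<in> \<U> \<Longrightarrow> countable (\<D> U) \<and> \<D> U \<subseteq> \<B> \<and> resolves (\<D> U) U"
    by metis
  define \<V> where "\<V> = (\<Union>U\<in>\<U>. \<D> U)"
  have "\<V> \<subseteq> \<B>"
    using \<D> by (auto simp: \<V>_def)
  moreover have "\<V> \<lesssim> omega1"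
    unfolding \<V>_def using \<D> by (intro lepoll_omega1_UN_countable \<U>(2)) blast
  ultimately obtain \<C> where "countable_open_resolution X \<V> \<C>"
    using omega1_resolvableD[OF res] by blast
  note \<C> = countable_open_resolutionD[OF this]
  have "resolves \<C> U" if "U \<in> \<U>" for U
  proof (rule resolves_trans)
    show "resolves (\<D> U) U"
      using \<D>[OF that] by blast
    show "resolves \<C> V" if "V \<in> \<D> U" for V
      using \<open>U \<in> \<U>\<close> that by (intro \<C>(3)) (auto simp: \<V>_def)
  qed
  with \<C>(1,2) show "\<exists>\<C>. countable_open_resolution X \<U> \<C>"
    by (rule ex_countable_open_resolutionI)
qed

section \<open>Factorizability as a property of open sets\<close>

definition cozero_in :: "'a topology \<Rightarrow> 'a set \<Rightarrow> bool" where
  "cozero_in X U \<longleftrightarrow>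
     (\<exists>\<phi>. continuous_map X euclideanreal \<phi> \<and> U = {x \<in> topspace X. \<phi> x \<noteq> 0})"

lemma openin_continuous_map_preimage_real:
  "continuous_map X euclideanreal \<phi> \<Longrightarrow> open W \<Longrightarrow> openin X {x \<in> topspace X. \<phi> x \<in> W}"
  by (simp add: openin_continuous_map_preimage)

lemma cozero_in_imp_openin: "cozero_in X U \<Longrightarrow> openin X U"
  unfolding cozero_in_def using openin_continuous_map_preimage_real[of X _ "- {0}"] by force

lemma completely_regular_imp_cozero_base:
  assumes "completely_regular_space X" "openin X U"
  shows "resolves (Collect (cozero_in X)) U"
  unfolding resolves_def
proof
  fix x assume x: "x \<in> U"
  then obtain f where f: "continuous_map X euclideanreal f" "f x = 0" "f ` (topspace X - U) \<subseteq> {1}"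
    using assms unfolding completely_regular_space_alt' by meson
  let ?C = "{y \<in> topspace X. f y - 1 \<noteq> 0}"
  have "continuous_map X euclideanreal (\<lambda>y. f y - 1)"
    using f(1) by (intro continuous_map_diff) simp_all
  then have coz: "cozero_in X ?C"
    unfolding cozero_in_def by (intro exI[of _ "\<lambda>y. f y - 1"]) simp
  have xC: "x \<in> ?C"
    using x f(2) openin_subset[OF assms(2)] by auto
  have CU: "?C \<subseteq> U"
    using f(3) by auto
  show "\<exists>C\<in>Collect (cozero_in X). x \<in> C \<and> C \<subseteq> U"
    by (rule bexI[of _ ?C]) (use coz xC CU in simp_all)
qed

lemma continuous_map_R_omega1_component:
  "continuous_map X R_omega1 f \<Longrightarrow> \<alpha> \<in> omega1 \<Longrightarrow> continuous_map X euclideanreal (\<lambda>x. f x \<alpha>)"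
  by (simp add: continuous_map_componentwise)

text \<open>
  The functions that define \<open>\<omega>\<^sub>1\<close> cozero sets are the coordinates of one map into
  \<open>\<real>\<^sup>\<kappa>\<close>, \<open>\<kappa> = \<omega>\<^sub>1\<close>; the preimages of a countable base of the intermediate space resolve all of them.
\<close>

lemma R_omega1_factorizable_imp_cozero_resolvable:
  assumes "R_omega1_factorizable X"
  shows "omega1_resolvable X (Collect (cozero_in X))"
  unfolding omega1_resolvable_def
proof (intro allI impI)
  fix \<U> assume coz: "\<U> \<subseteq> Collect (cozero_in X)" and "\<U> \<lesssim> omega1"
  then obtain e where e: "\<U> \<subseteq> e ` omega1"
    using lepoll_iff by metis
  \<comment> \<open>The enumeration \<open>e\<close> may take values outside \<open>\<U>\<close>; there any continuous function does.\<close>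
  have "\<forall>\<alpha>. \<exists>\<phi>. continuous_map X euclideanreal \<phi> \<and>
      (e \<alpha> \<in> \<U> \<longrightarrow> e \<alpha> = {x \<in> topspace X. \<phi> x \<noteq> 0})"
  proof (rule allI)
    fix \<alpha>
    show "\<exists>\<phi>. continuous_map X euclideanreal \<phi> \<and>
        (e \<alpha> \<in> \<U> \<longrightarrow> e \<alpha> = {x \<in> topspace X. \<phi> x \<noteq> 0})"
    proof (cases "e \<alpha> \<in> \<U>")
      case True
      then show ?thesis
        using coz unfolding cozero_in_def by blast
    next
      case False
      then show ?thesis
        by (intro exI[of _ "\<lambda>_. 0"]) simp
    qed
  qed
  from choice[OF this] obtain \<phi> where "\<forall>\<alpha>. continuous_map X euclideanreal (\<phi> \<alpha>) \<and>
      (e \<alpha> \<in> \<U> \<longrightarrow> e \<alpha> = {x \<in> topspace X. \<phi> \<alpha> x \<noteq> 0})" ..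
  then have \<phi>: "continuous_map X euclideanreal (\<phi> \<alpha>)"
    "e \<alpha> \<in> \<U> \<Longrightarrow> e \<alpha> = {x \<in> topspace X. \<phi> \<alpha> x \<noteq> 0}" for \<alpha>
    by blast+
  define f where "f x = (\<lambda>\<alpha>\<in>omega1. \<phi> \<alpha> x)" for x
  have "continuous_map X R_omega1 f"
    using \<phi>(1) by (auto simp: continuous_map_componentwise f_def)
  then obtain Y :: "(nat \<Rightarrow> real) topology" and h g where Y: "second_countable_space Y"
    and h: "continuous_map X Y h" and g: "continuous_map Y R_omega1 g"
    and fgh: "\<And>x. x \<in> topspace X \<Longrightarrow> f x = g (h x)"
    using assms unfolding R_omega1_factorizable_def comp_def by metis
  obtain \<V> where \<V>: "countable \<V>" "\<And>V. V \<in> \<V> \<Longrightarrow> openin Y V"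
    "\<And>W y. openin Y W \<Longrightarrow> y \<in> W \<Longrightarrow> \<exists>V\<in>\<V>. y \<in> V \<and> V \<subseteq> W"
    using Y unfolding second_countable_space_def by metis
  let ?pre = "\<lambda>V. {x \<in> topspace X. h x \<in> V}"
  have res: "resolves (?pre ` \<V>) U" if U: "U \<in> \<U>" for U
    unfolding resolves_def
  proof
    fix x assume x: "x \<in> U"
    obtain \<alpha> where \<alpha>: "\<alpha> \<in> omega1" "U = e \<alpha>"
      using U e by blast
    have U_eq: "U = {x \<in> topspace X. \<phi> \<alpha> x \<noteq> 0}"
      using \<phi>(2)[of \<alpha>] U \<alpha>(2) by simp
    let ?W = "{y \<in> topspace Y. g y \<alpha> \<in> - {0}}"
    have *: "h z \<in> ?W \<longleftrightarrow> z \<in> U" if "z \<in> topspace X" for z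
      using that fgh[OF that] \<alpha>(1) h U_eq by (auto simp: continuous_map_def f_def dest: fun_cong[of _ _ \<alpha>])
    have "openin Y ?W"
      using continuous_map_R_omega1_component[OF g \<alpha>(1)]
      by (intro openin_continuous_map_preimage_real) auto
    moreover have xX: "x \<in> topspace X"
      using x U_eq by blast
    ultimately obtain V where "V \<in> \<V>" "h x \<in> V" "V \<subseteq> ?W"
      using \<V>(3) * x by meson
    then show "\<exists>C\<in>?pre ` \<V>. x \<in> C \<and> C \<subseteq> U"
      using * xX by (intro bexI[of _ "?pre V"]) auto
  qed
  have op: "openin X C" if "C \<in> ?pre ` \<V>" for C
    using that \<V>(2) openin_continuous_map_preimage[OF h] by blast
  show "\<exists>\<C>. countable_open_resolution X \<U> \<C>"
    using countable_image[OF \<V>(1)] op res by (rule ex_countable_open_resolutionI)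
qed

lemma subspace_nat_real_tychonoff_second_countable:
  fixes S :: "(nat \<Rightarrow> real) set"
  shows "tychonoff_space (top_of_set S)" "second_countable_space (top_of_set S)"
proof -
  have "completely_regular_space (euclidean :: (nat \<Rightarrow> real) topology)"
    by (simp add: normal_imp_completely_regular_space_gen metrizable_imp_normal_space
        metrizable_space_euclidean)
  then show "tychonoff_space (top_of_set S)"
    unfolding tychonoff_space_def
    by (simp add: completely_regular_space_subtopology Hausdorff_space_subtopology)
  obtain \<B> :: "(nat \<Rightarrow> real) set set" where \<B>: "countable \<B>" "topological_basis \<B>"
    using ex_countable_basis by blast
  show "second_countable_space (top_of_set S)"
    unfolding second_countable_space_def
  proof (intro exI[of _ "(\<lambda>B. S \<inter> B) ` \<B>"] conjI ballI allI impI)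
    show "countable ((\<lambda>B. S \<inter> B) ` \<B>)"
      using \<B>(1) by simp
  next
    fix V assume "V \<in> (\<lambda>B. S \<inter> B) ` \<B>"
    then show "openin (top_of_set S) V"
      using \<B>(2) topological_basis_open by blast
  next
    fix U x assume "openin (top_of_set S) U \<and> x \<in> U"
    then obtain T where T: "open T" "U = S \<inter> T" "x \<in> T" "x \<in> S"
      by (auto simp: openin_open)
    obtain B where "B \<in> \<B>" "x \<in> B" "B \<subseteq> T"
      using topological_basisE[OF \<B>(2) T(1,3)] by metis
    with T show "\<exists>V\<in>(\<lambda>B. S \<inter> B) ` \<B>. x \<in> V \<and> V \<subseteq> U"
      by (intro bexI[of _ "S \<inter> B"]) auto
  qed
qed

text \<open>
  A resolution of the sets \<open>{x. f x \<alpha> \<in> G}\<close> can be refined to one by countably many cozero sets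
  \<open>{x. \<phi>\<^sub>n x \<noteq> 0}\<close>, because each open set is a countable union of cozero sets. The diagonal map
  \<open>h = (\<phi>\<^sub>n)\<^sub>n\<close> into \<open>\<real>\<^sup>\<omega>\<close> then determines \<open>f\<close>, and the sets \<open>{y. y n \<noteq> 0}\<close> witness the
  continuity of the induced map on \<open>h ` X\<close>.
\<close>

lemma omega1_resolvable_imp_R_omega1_factorizable:
  assumes ty: "tychonoff_space X" and res: "omega1_resolvable X (Collect (openin X))"
  shows "R_omega1_factorizable X"
proof (rule R_omega1_factorizableI[OF ty])
  fix f assume f: "continuous_map X R_omega1 f"
  have creg: "completely_regular_space X"
    using ty by (simp add: tychonoff_space_def)
  define T where "T \<alpha> W = {x \<in> topspace X. f x \<alpha> \<in> W}" for \<alpha> and W :: "real set"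
  have T: "openin X (T \<alpha> W)" if "\<alpha> \<in> omega1" "open W" for \<alpha> W
    unfolding T_def using that f
    by (intro openin_continuous_map_preimage_real continuous_map_R_omega1_component) auto
  obtain \<G> :: "real set set" where \<G>: "countable \<G>" "topological_basis \<G>"
    using ex_countable_basis by blast
  define \<U> where "\<U> = (\<Union>\<alpha>\<in>omega1. T \<alpha> ` \<G>)"
  have "\<U> \<subseteq> Collect (openin X)"
    using T topological_basis_open[OF \<G>(2)] by (auto simp: \<U>_def)
  moreover have "\<U> \<lesssim> omega1"
    unfolding \<U>_def using \<G>(1) by (intro lepoll_omega1_UN_countable) auto
  ultimately obtain \<C> where "countable_open_resolution X \<U> \<C>"
    using omega1_resolvableD[OF res] by blast
  note \<C> = countable_open_resolutionD[OF this]
  have "omega1_resolvable X (Collect (cozero_in X))"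
    using res by (rule omega1_resolvable_subset) (auto intro: cozero_in_imp_openin)
  then have "\<exists>\<D>. countable \<D> \<and> \<D> \<subseteq> Collect (cozero_in X) \<and> resolves \<D> C" if "C \<in> \<C>" for C
    by (rule omega1_resolvable_imp_countable_subcover
        [OF _ completely_regular_imp_cozero_base[OF creg \<C>(2)[OF that]]]) blast
  then obtain \<D> where \<D>: "\<And>C. C \<in> \<C> \<Longrightarrow>
      countable (\<D> C) \<and> \<D> C \<subseteq> Collect (cozero_in X) \<and> resolves (\<D> C) C"
    by metis
  \<comment> \<open>The empty set is added so that \<open>\<E>\<close> can be enumerated by \<open>from_nat_into\<close>.\<close>
  define \<E> where "\<E> = insert {} (\<Union>C\<in>\<C>. \<D> C)"
  have \<E>c: "countable \<E>" "\<E> \<noteq> {}"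
    using \<C>(1) \<D> by (auto simp: \<E>_def)
  have "cozero_in X {}"
    unfolding cozero_in_def by (intro exI[of _ "\<lambda>_. 0"]) simp
  then have \<E>z: "cozero_in X E" if "E \<in> \<E>" for E
    using that \<D> by (auto simp: \<E>_def)
  have \<E>r: "resolves \<E> (T \<alpha> G)" if "\<alpha> \<in> omega1" "G \<in> \<G>" for \<alpha> G
  proof (rule resolves_trans)
    show "resolves \<C> (T \<alpha> G)"
      using that by (intro \<C>(3)) (auto simp: \<U>_def)
    show "resolves \<E> C" if "C \<in> \<C>" for C
      using \<D>[OF that] that by (auto simp: \<E>_def intro: resolves_mono)
  qed
  have "\<exists>\<phi>. continuous_map X euclideanreal \<phi> \<and> from_nat_into \<E> n = {x \<in> topspace X. \<phi> x \<noteq> 0}" for n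
    using \<E>z from_nat_into[OF \<E>c(2)] unfolding cozero_in_def by metis
  then obtain \<phi> where \<phi>: "\<And>n. continuous_map X euclideanreal (\<phi> n)"
    "\<And>n. from_nat_into \<E> n = {x \<in> topspace X. \<phi> n x \<noteq> 0}"
    by metis
  define h where "h x = (\<lambda>n. \<phi> n x)" for x
  \<comment> \<open>An open condition on one coordinate of \<open>f\<close> that holds at \<open>x\<close> is enforced near \<open>x\<close> by a
    single \<open>\<phi> n\<close>; that \<open>h\<close> determines \<open>f\<close> and that the induced map is continuous both
    follow from this.\<close>
  have loc: "\<exists>n. \<phi> n x \<noteq> 0 \<and> (\<forall>z\<in>topspace X. \<phi> n z \<noteq> 0 \<longrightarrow> f z \<alpha> \<in> W)"
    if x: "x \<in> topspace X" and \<alpha>: "\<alpha> \<in> omega1" and W: "open W" "f x \<alpha> \<in> W" for x \<alpha> W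
  proof -
    obtain G where G: "G \<in> \<G>" "f x \<alpha> \<in> G" "G \<subseteq> W"
      using topological_basisE[OF \<G>(2)] W by metis
    then obtain E where E: "E \<in> \<E>" "x \<in> E" "E \<subseteq> T \<alpha> G"
      using resolvesD[OF \<E>r[OF \<alpha> G(1)], of x] x by (auto simp: T_def)
    obtain n where "from_nat_into \<E> n = E"
      using from_nat_into_surj \<E>c(1) E(1) by metis
    then show ?thesis
      using E G(3) \<phi>(2)[of n] by (intro exI[of _ n]) (auto simp: T_def)
  qed
  have fext: "f x \<in> extensional omega1" if "x \<in> topspace X" for x
    using f that by (auto simp: continuous_map_componentwise)
  have inj: "f x = f z" if "x \<in> topspace X" "z \<in> topspace X" "h x = h z" for x z
  proof (rule extensionalityI[OF fext fext], use that in simp, use that in simp, rule ccontr)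
    fix \<alpha> assume "\<alpha> \<in> omega1" "f x \<alpha> \<noteq> f z \<alpha>"
    then obtain n where "\<phi> n x \<noteq> 0" "\<phi> n z \<noteq> 0 \<longrightarrow> f z \<alpha> \<in> - {f z \<alpha>}"
      using loc[of x \<alpha> "- {f z \<alpha>}"] \<open>x \<in> topspace X\<close> \<open>z \<in> topspace X\<close> by auto
    moreover have "\<phi> n x = \<phi> n z"
      using fun_cong[OF \<open>h x = h z\<close>, of n] by (simp add: h_def)
    ultimately show False
      by auto
  qed
  define S where "S = h ` topspace X"
  define g where "g y = f (inv_into (topspace X) h y)" for y
  have gh: "g (h x) = f x" if "x \<in> topspace X" for x
    unfolding g_def using that
    by (intro inj) (auto intro: inv_into_into f_inv_into_f)
  have h: "continuous_map X (top_of_set S) h"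
    unfolding continuous_map_in_subtopology
    using \<phi>(1) by (auto simp: S_def h_def continuous_map_componentwise_UNIV
        simp flip: euclidean_product_topology)
  have "continuous_map (top_of_set S) euclideanreal (\<lambda>y. g y \<alpha>)" if \<alpha>: "\<alpha> \<in> omega1" for \<alpha>
    unfolding continuous_map_def
  proof (intro conjI allI impI)
    fix W :: "real set" assume "openin euclideanreal W"
    then have W: "open W" by simp
    show "openin (top_of_set S) {y \<in> topspace (top_of_set S). g y \<alpha> \<in> W}"
    proof (subst openin_subopen, clarsimp)
      fix y assume "y \<in> S" "g y \<alpha> \<in> W"
      then obtain x where x: "x \<in> topspace X" "y = h x" "f x \<alpha> \<in> W"
        using gh by (auto simp: S_def)
      then obtain n where n: "\<phi> n x \<noteq> 0" "\<And>z. z \<in> topspace X \<Longrightarrow> \<phi> n z \<noteq> 0 \<Longrightarrow> f z \<alpha> \<in> W"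
        using loc[OF x(1) \<alpha> W] by blast
      let ?N = "S \<inter> (\<lambda>y. y n) -` (- {0})"
      have "openin (top_of_set S) ?N"
        by (intro openin_open_Int open_vimage continuous_on_product_coordinates) auto
      moreover have "y \<in> ?N"
        using x n(1) \<open>y \<in> S\<close> by (auto simp: h_def)
      moreover have "?N \<subseteq> {y \<in> S. g y \<alpha> \<in> W}"
        using n(2) gh by (auto simp: S_def h_def)
      ultimately show "\<exists>N. openin (top_of_set S) N \<and> y \<in> N \<and> N \<subseteq> {y \<in> S. g y \<alpha> \<in> W}"
        by blast
    qed
  qed auto
  moreover have "g ` S \<subseteq> extensional omega1"
    using gh fext by (auto simp: S_def)
  ultimately have "continuous_map (top_of_set S) R_omega1 g"
    by (simp add: continuous_map_componentwise)
  then show "\<exists>(Y :: (nat \<Rightarrow> real) topology) h g. tychonoff_space Y \<and> second_countable_space Y \<and>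
      continuous_map X Y h \<and> continuous_map Y R_omega1 g \<and> (\<forall>x\<in>topspace X. f x = (g \<circ> h) x)"
    using h gh subspace_nat_real_tychonoff_second_countable
    by (intro exI[of _ "top_of_set S"] exI[of _ h] exI[of _ g]) auto
qed

theorem R_omega1_factorizable_iff_omega1_resolvable:
  "R_omega1_factorizable X \<longleftrightarrow>
     tychonoff_space X \<and> omega1_resolvable X (Collect (openin X))"
proof
  assume X: "R_omega1_factorizable X"
  then have ty: "tychonoff_space X"
    by (simp add: R_omega1_factorizable_def)
  then have "resolves (Collect (cozero_in X)) U" if "openin X U" for U
    using that completely_regular_imp_cozero_base by (auto simp: tychonoff_space_def)
  then show "tychonoff_space X \<and> omega1_resolvable X (Collect (openin X))"
    using ty omega1_resolvable_from_base R_omega1_factorizable_imp_cozero_resolvable[OF X] by blast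
next
  assume "tychonoff_space X \<and> omega1_resolvable X (Collect (openin X))"
  then show "R_omega1_factorizable X"
    using omega1_resolvable_imp_R_omega1_factorizable by blast
qed

section \<open>Subspaces, sums and products\<close>

lemma R_omega1_factorizable_subtopology:
  assumes "R_omega1_factorizable X"
  shows "R_omega1_factorizable (subtopology X S)"
  unfolding R_omega1_factorizable_iff_omega1_resolvable
proof
  have X: "tychonoff_space X" "omega1_resolvable X (Collect (openin X))"
    using assms by (auto simp: R_omega1_factorizable_iff_omega1_resolvable)
  show "tychonoff_space (subtopology X S)"
    using X(1) by (simp add: tychonoff_space_def completely_regular_space_subtopology
        Hausdorff_space_subtopology)
  show "omega1_resolvable (subtopology X S) (Collect (openin (subtopology X S)))"
    unfolding omega1_resolvable_def
  proof (intro allI impI)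
    fix \<U> assume \<U>: "\<U> \<subseteq> Collect (openin (subtopology X S))" "\<U> \<lesssim> omega1"
    then have "\<exists>T. openin X T \<and> U = T \<inter> S" if "U \<in> \<U>" for U
      using that by (auto simp: openin_subtopology)
    then obtain T where T: "\<And>U. U \<in> \<U> \<Longrightarrow> openin X (T U) \<and> U = T U \<inter> S"
      by metis
    have "T ` \<U> \<subseteq> Collect (openin X)" "T ` \<U> \<lesssim> omega1"
      using T lepoll_trans[OF image_lepoll \<U>(2)] by blast+
    then obtain \<C> where "countable_open_resolution X (T ` \<U>) \<C>"
      using omega1_resolvableD[OF X(2)] by blast
    note \<C> = countable_open_resolutionD[OF this]
    have res: "resolves ((\<lambda>C. C \<inter> S) ` \<C>) U" if U: "U \<in> \<U>" for U
      unfolding resolves_def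
    proof
      fix x assume x: "x \<in> U"
      then have "x \<in> T U"
        using T[OF U] by blast
      then obtain C where "C \<in> \<C>" "x \<in> C" "C \<subseteq> T U"
        using resolvesD[OF \<C>(3)[OF imageI[OF U]]] by blast
      then show "\<exists>D\<in>(\<lambda>C. C \<inter> S) ` \<C>. x \<in> D \<and> D \<subseteq> U"
        using conjunct2[OF T[OF U]] x by (intro bexI[of _ "C \<inter> S"]) auto
    qed
    have op: "openin (subtopology X S) D" if "D \<in> (\<lambda>C. C \<inter> S) ` \<C>" for D
      using that \<C>(2) by (auto simp: openin_subtopology)
    show "\<exists>\<C>. countable_open_resolution (subtopology X S) \<U> \<C>"
      using countable_image[OF \<C>(1)] op res by (rule ex_countable_open_resolutionI)
  qed
qed

lemma continuous_map_from_sum_topology: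
  assumes "\<And>i. i \<in> I \<Longrightarrow> continuous_map (X i) Y (\<lambda>x. f (i, x))"
  shows "continuous_map (sum_topology X I) Y f"
  unfolding continuous_map_def openin_sum_topology
proof (intro conjI allI impI ballI)
  show "f \<in> topspace (sum_topology X I) \<rightarrow> topspace Y"
    using continuous_map_image_subset_topspace[OF assms] by fastforce
next
  fix V i assume "openin Y V" "i \<in> I"
  then have "openin (X i) {x \<in> topspace (X i). f (i, x) \<in> V}"
    using assms openin_continuous_map_preimage by fast
  then show "openin (X i) {x. (i, x) \<in> {p \<in> topspace (sum_topology X I). f p \<in> V}}"
    using \<open>i \<in> I\<close> by simp
qed auto

lemma openin_sum_topology_slice:
  assumes "i \<in> I" "openin (X i) U"
  shows "openin (sum_topology X I) ({i} \<times> U)"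
proof -
  have "{x. (j, x) \<in> {i} \<times> U} = (if j = i then U else {})" for j
    by auto
  then show ?thesis
    unfolding openin_sum_topology using assms openin_subset[OF assms(2)] by auto
qed

lemma tychonoff_space_sum_topology:
  assumes "\<And>i. i \<in> I \<Longrightarrow> tychonoff_space (X i)"
  shows "tychonoff_space (sum_topology X I)"
  unfolding tychonoff_space_def
proof
  show "completely_regular_space (sum_topology X I)"
    unfolding completely_regular_space_alt'
  proof (intro allI impI)
    fix U p assume U: "openin (sum_topology X I) U" and p: "p \<in> U"
    obtain i x where ix: "p = (i, x)" "i \<in> I"
      using p openin_subset[OF U] by auto
    have "openin (X i) {x. (i, x) \<in> U}"
      using U ix(2) by (simp add: openin_sum_topology)
    then obtain f where f: "continuous_map (X i) euclideanreal f" "f x = 0"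
      "f ` (topspace (X i) - {x. (i, x) \<in> U}) \<subseteq> {1}"
      using assms[OF ix(2)] p ix(1) unfolding tychonoff_space_def completely_regular_space_alt'
      by (metis mem_Collect_eq)
    let ?F = "\<lambda>(j, y). if j = i then f y else 1"
    have "continuous_map (sum_topology X I) euclideanreal ?F"
    proof (rule continuous_map_from_sum_topology)
      show "continuous_map (X j) euclideanreal (\<lambda>y. ?F (j, y))" for j
        using f(1) by (cases "j = i") auto
    qed
    moreover have "?F p = 0" "?F ` (topspace (sum_topology X I) - U) \<subseteq> {1}"
      using f(2) ix image_subset_iff[THEN iffD1, OF f(3)] by auto
    ultimately show "\<exists>f. continuous_map (sum_topology X I) euclideanreal f \<and> f p = 0 \<and>
        f ` (topspace (sum_topology X I) - U) \<subseteq> {1}"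
      by blast
  qed
  show "Hausdorff_space (sum_topology X I)"
    unfolding Hausdorff_space_def
  proof (intro allI impI)
    fix p q
    assume pq: "p \<in> topspace (sum_topology X I) \<and> q \<in> topspace (sum_topology X I) \<and> p \<noteq> q"
    then obtain i x j y where ij: "p = (i, x)" "q = (j, y)" "i \<in> I" "j \<in> I"
      "x \<in> topspace (X i)" "y \<in> topspace (X j)"
      by (cases p, cases q) auto
    show "\<exists>U V. openin (sum_topology X I) U \<and> openin (sum_topology X I) V \<and>
        p \<in> U \<and> q \<in> V \<and> disjnt U V"
    proof (cases "i = j")
      case True
      then obtain U V where "openin (X i) U" "openin (X i) V" "x \<in> U" "y \<in> V" "disjnt U V"
        using assms[OF ij(3)] ij pq unfolding tychonoff_space_def Hausdorff_space_def by blast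
      then show ?thesis
        using openin_sum_topology_slice[of _ I X] ij True
        by (intro exI[of _ "{i} \<times> U"] exI[of _ "{i} \<times> V"]) (auto simp: disjnt_def)
    next
      case False
      then show ?thesis
        using openin_sum_topology_slice[of _ I X] ij
        by (intro exI[of _ "{i} \<times> topspace (X i)"] exI[of _ "{j} \<times> topspace (X j)"])
          (auto simp: disjnt_def)
    qed
  qed
qed

lemma R_omega1_factorizable_sum_topology:
  assumes "countable I" "\<And>i. i \<in> I \<Longrightarrow> R_omega1_factorizable (X i)"
  shows "R_omega1_factorizable (sum_topology X I)"
  unfolding R_omega1_factorizable_iff_omega1_resolvable
proof
  have X: "tychonoff_space (X i)" "omega1_resolvable (X i) (Collect (openin (X i)))"
    if "i \<in> I" for i
    using assms(2)[OF that] by (auto simp: R_omega1_factorizable_iff_omega1_resolvable)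
  show "tychonoff_space (sum_topology X I)"
    using X(1) by (rule tychonoff_space_sum_topology)
  show "omega1_resolvable (sum_topology X I) (Collect (openin (sum_topology X I)))"
    unfolding omega1_resolvable_def
  proof (intro allI impI)
    fix \<U> assume \<U>: "\<U> \<subseteq> Collect (openin (sum_topology X I))" "\<U> \<lesssim> omega1"
    let ?s = "\<lambda>i U. {x. (i, x) \<in> U}"
    have "\<exists>\<C>. countable_open_resolution (X i) (?s i ` \<U>) \<C>"
      if "i \<in> I" for i
    proof -
      have "?s i ` \<U> \<subseteq> Collect (openin (X i))"
        using \<U>(1) that by (auto simp: openin_sum_topology)
      moreover have "?s i ` \<U> \<lesssim> omega1"
        using lepoll_trans[OF image_lepoll \<U>(2)] .
      ultimately show ?thesis
        by (rule omega1_resolvableD[OF X(2)[OF that]])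
    qed
    then obtain \<C> where "\<And>i. i \<in> I \<Longrightarrow> countable_open_resolution (X i) (?s i ` \<U>) (\<C> i)"
      by metis
    note \<C> = countable_open_resolutionD[OF this]
    let ?\<C> = "\<Union>i\<in>I. (\<lambda>C. {i} \<times> C) ` \<C> i"
    have "countable ?\<C>"
      using assms(1) \<C>(1) by (intro countable_UN countable_image)
    moreover have "openin (sum_topology X I) D" if "D \<in> ?\<C>" for D
      using that \<C>(2) by (auto intro: openin_sum_topology_slice)
    moreover have "resolves ?\<C> U" if U: "U \<in> \<U>" for U
      unfolding resolves_def
    proof
      fix p assume p: "p \<in> U"
      have "U \<subseteq> topspace (sum_topology X I)"
        using U \<U>(1) openin_subset by blast
      then obtain i x where ix: "p = (i, x)" "i \<in> I"
        using p by auto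
      then obtain C where "C \<in> \<C> i" "x \<in> C" "C \<subseteq> ?s i U"
        using resolvesD[OF \<C>(3)[OF ix(2) imageI[OF U]], of x] p by auto
      then show "\<exists>D\<in>?\<C>. p \<in> D \<and> D \<subseteq> U"
        using ix by (intro bexI[of _ "{i} \<times> C"]) auto
    qed
    ultimately show "\<exists>\<C>. countable_open_resolution (sum_topology X I) \<U> \<C>"
      by (rule ex_countable_open_resolutionI)
  qed
qed

definition open_boxes :: "('i \<Rightarrow> 'a topology) \<Rightarrow> 'i set \<Rightarrow> ('i \<Rightarrow> 'a) set set" where
  "open_boxes X I = {PiE I U | U. finite {i \<in> I. U i \<noteq> topspace (X i)} \<and>
     (\<forall>i\<in>I. openin (X i) (U i))}"

text \<open>
  A family of \<open>\<omega>\<^sub>1\<close> boxes has \<open>\<omega>\<^sub>1\<close> sides in each factor, which are resolved there. A box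
  restricts only finitely many coordinates, so finite intersections of cylinders over the
  resolving sets are enough, and countably many factors contribute countably many of these.
\<close>

lemma open_boxes_resolvable:
  assumes I: "countable I"
    and X: "\<And>i. i \<in> I \<Longrightarrow> omega1_resolvable (X i) (Collect (openin (X i)))"
  shows "omega1_resolvable (product_topology X I) (open_boxes X I)"
  unfolding omega1_resolvable_def
proof (intro allI impI)
  let ?P = "product_topology X I"
  fix \<U> assume \<U>: "\<U> \<subseteq> open_boxes X I" "\<U> \<lesssim> omega1"
  have "\<forall>B\<in>\<U>. \<exists>V. B = PiE I V \<and> finite {i \<in> I. V i \<noteq> topspace (X i)} \<and>
      (\<forall>i\<in>I. openin (X i) (V i))"
    using \<U>(1) by (auto simp: open_boxes_def)
  from bchoice[OF this] obtain V where "\<forall>B\<in>\<U>. B = PiE I (V B) \<and>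
      finite {i \<in> I. V B i \<noteq> topspace (X i)} \<and> (\<forall>i\<in>I. openin (X i) (V B i))" ..
  then have V: "B = PiE I (V B)" "finite {i \<in> I. V B i \<noteq> topspace (X i)}"
    "\<And>i. i \<in> I \<Longrightarrow> openin (X i) (V B i)" if "B \<in> \<U>" for B
    using that by blast+
  have "\<exists>\<C>. countable_open_resolution (X i) ((\<lambda>B. V B i) ` \<U>) \<C>"
    if "i \<in> I" for i
  proof -
    have "(\<lambda>B. V B i) ` \<U> \<subseteq> Collect (openin (X i))"
      using V(3) that by auto
    moreover have "(\<lambda>B. V B i) ` \<U> \<lesssim> omega1"
      using lepoll_trans[OF image_lepoll \<U>(2)] .
    ultimately show ?thesis
      by (rule omega1_resolvableD[OF X[OF that]])
  qed
  then obtain \<C> where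
    "\<And>i. i \<in> I \<Longrightarrow> countable_open_resolution (X i) ((\<lambda>B. V B i) ` \<U>) (\<C> i)"
    by metis
  note \<C> = countable_open_resolutionD[OF this]
  define cyl where "cyl i C = {x \<in> topspace ?P. x i \<in> C}" for i C
  define \<S> where "\<S> = (\<Union>i\<in>I. cyl i ` \<C> i)"
  have \<S>o: "openin ?P S" if "S \<in> \<S>" for S
  proof -
    from that obtain i C where "S = cyl i C" "i \<in> I" "C \<in> \<C> i"
      by (auto simp: \<S>_def)
    then show ?thesis
      unfolding cyl_def using \<C>(2)
      by (simp only: openin_continuous_map_preimage[OF continuous_map_product_projection])
  qed
  \<comment> \<open>The whole space is always intersected because a box may restrict no coordinate: then
    \<open>\<F> = {}\<close>, and \<open>\<Inter>{}\<close> is not contained in the product.\<close>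
  define \<K> where "\<K> = (\<lambda>\<F>. \<Inter>(insert (topspace ?P) \<F>)) ` {\<F>. finite \<F> \<and> \<F> \<subseteq> \<S>}"
  have "countable \<S>"
    using I \<C>(1) by (auto simp: \<S>_def)
  then have "countable \<K>"
    unfolding \<K>_def by (intro countable_image countable_Collect_finite_subset)
  moreover have "openin ?P K" if "K \<in> \<K>" for K
  proof -
    from that obtain \<F> where \<F>: "finite \<F>" "\<F> \<subseteq> \<S>" "K = \<Inter>(insert (topspace ?P) \<F>)"
      by (auto simp: \<K>_def)
    show ?thesis
      unfolding \<F>(3)
    proof (rule openin_Inter)
      show "openin ?P S" if "S \<in> insert (topspace ?P) \<F>" for S
        using that \<F>(2) \<S>o openin_topspace by blast
    qed (use \<F>(1) in simp_all)
  qed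
  moreover have "resolves \<K> B" if B: "B \<in> \<U>" for B
    unfolding resolves_def
  proof
    fix x assume x: "x \<in> B"
    let ?J = "{i \<in> I. V B i \<noteq> topspace (X i)}"
    have xV: "x i \<in> V B i" if "i \<in> I" for i
      using x V(1)[OF B] that by blast
    have "\<exists>C\<in>\<C> i. x i \<in> C \<and> C \<subseteq> V B i" if "i \<in> I" for i
      by (rule resolvesD[OF \<C>(3)[OF that imageI[OF B]] xV[OF that]])
    then obtain C where C: "\<And>i. i \<in> I \<Longrightarrow> C i \<in> \<C> i \<and> x i \<in> C i \<and> C i \<subseteq> V B i"
      by metis
    let ?\<F> = "(\<lambda>i. cyl i (C i)) ` ?J"
    let ?K = "\<Inter>(insert (topspace ?P) ?\<F>)"
    have "?\<F> \<subseteq> \<S>"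
      using C by (auto simp: \<S>_def)
    then have K: "?K \<in> \<K>"
      unfolding \<K>_def using V(2)[OF B] by blast
    have "x \<in> PiE I (V B)"
      using x V(1)[OF B] by simp
    moreover have "PiE I (V B) \<subseteq> topspace ?P"
      unfolding topspace_product_topology comp_def
      using openin_subset[OF V(3)[OF B]] by (intro PiE_mono)
    ultimately have xP: "x \<in> topspace ?P"
      by blast
    have "x \<in> ?K"
      using xP C by (auto simp: cyl_def)
    moreover have "?K \<subseteq> B"
    proof
      fix z assume z: "z \<in> ?K"
      have "z i \<in> V B i" if "i \<in> I" for i
      proof (cases "i \<in> ?J")
        case True
        then show ?thesis
          using z C[OF that] by (auto simp: cyl_def)
      next
        case False
        then show ?thesis
          using z that by (auto simp: PiE_iff)
      qed
      moreover have "z \<in> extensional I"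
        using z by (auto simp: PiE_iff)
      ultimately show "z \<in> B"
        by (subst V(1)[OF B]) (simp add: PiE_iff)
    qed
    ultimately show "\<exists>K\<in>\<K>. x \<in> K \<and> K \<subseteq> B"
      using K by (intro bexI[of _ ?K] conjI)
  qed
  ultimately show "\<exists>\<C>. countable_open_resolution ?P \<U> \<C>"
    by (rule ex_countable_open_resolutionI)
qed

lemma R_omega1_factorizable_product_topology:
  assumes "countable I" "\<And>i. i \<in> I \<Longrightarrow> R_omega1_factorizable (X i)"
  shows "R_omega1_factorizable (product_topology X I)"
  unfolding R_omega1_factorizable_iff_omega1_resolvable
proof
  have X: "tychonoff_space (X i)" "omega1_resolvable (X i) (Collect (openin (X i)))"
    if "i \<in> I" for i
    using assms(2)[OF that] by (auto simp: R_omega1_factorizable_iff_omega1_resolvable)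
  show "tychonoff_space (product_topology X I)"
    using X(1) by (simp add: tychonoff_space_def completely_regular_space_product_topology
        Hausdorff_space_product_topology)
  show "omega1_resolvable (product_topology X I) (Collect (openin (product_topology X I)))"
  proof (rule omega1_resolvable_from_base)
    show "omega1_resolvable (product_topology X I) (open_boxes X I)"
      using assms(1) X(2) by (rule open_boxes_resolvable)
    show "resolves (open_boxes X I) U" if U: "openin (product_topology X I) U" for U
      unfolding resolves_def
    proof
      fix x assume "x \<in> U"
      then obtain V where "finite {i \<in> I. V i \<noteq> topspace (X i)}" "\<forall>i\<in>I. openin (X i) (V i)"
        "x \<in> PiE I V" "PiE I V \<subseteq> U"
        using U unfolding openin_product_topology_alt by meson
      then show "\<exists>B\<in>open_boxes X I. x \<in> B \<and> B \<subseteq> U"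
        unfolding open_boxes_def by (intro bexI[of _ "PiE I V"] conjI CollectI exI[of _ V]) simp_all
    qed
  qed
qed

theorem theorem3p3:
  shows "(\<forall>(X :: 'a topology) S. S \<subseteq> topspace X \<longrightarrow> R_omega1_factorizable X \<longrightarrow>
            R_omega1_factorizable (subtopology X S))
       \<and> (\<forall>X :: nat \<Rightarrow> 'b topology. (\<forall>n. R_omega1_factorizable (X n)) \<longrightarrow>
            R_omega1_factorizable (sum_topology X UNIV))
       \<and> (\<forall>X :: nat \<Rightarrow> 'c topology. (\<forall>n. R_omega1_factorizable (X n)) \<longrightarrow>
            R_omega1_factorizable (product_topology X UNIV))"
proof (intro conjI allI impI)
  show "R_omega1_factorizable (subtopology X S)"
    if "S \<subseteq> topspace X" "R_omega1_factorizable X" for X :: "'a topology" and S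
    using that(2) by (rule R_omega1_factorizable_subtopology)
  show "R_omega1_factorizable (sum_topology X UNIV)"
    if "\<forall>n. R_omega1_factorizable (X n)" for X :: "nat \<Rightarrow> 'b topology"
    using that by (intro R_omega1_factorizable_sum_topology) simp_all
  show "R_omega1_factorizable (product_topology X UNIV)"
    if "\<forall>n. R_omega1_factorizable (X n)" for X :: "nat \<Rightarrow> 'c topology"
    using that by (intro R_omega1_factorizable_product_topology) simp_all
qed

end
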